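(* Let $S$ be a nonempty commutative cancellative Hausdorff topological semigroup whose underlying space is locally compact and pseudocompact, and which has open shifts. Then $S$ is a compact topological group; that is, $S$ with its given multiplication is a group, and with its given topology it is a compact topological group.
   Context: All topological spaces are assumed to be Hausdorff. A topological semigroup is a semigroup with a topology for which the multiplication $S\times S\to S$ is continuous. It is cancellative if $ax=ay$ implies $x=y$ and $xa=ya$ implies $x=y$ for all $a,x,y\in S$. A shift (also called a translation) of a commutative semigroup $S$ is a map $S\to S$, $x\mapsto ax$, with $a\in S$; $S$ has open shifts if every shift is an open map, i.e. $aU$ is open in $S$ for every $a\in S$ and every open $U\subseteq S$. A space is pseudocompact if every continuous real-valued function on it is bounded. *)

theory Defs
  imports "HOL-Analysis.Analysis" "HOL-Algebra.Group"
begin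

(* The carrier of a topological semigroup or group is the whole topspace.  Closure of the
   carrier under the operations is part of continuous_map.  The Hausdorff property is not
   part of these definitions; it is to be assumed separately. *)

locale topological_semigroup =
  fixes X :: "'a topology" and m :: "'a \<Rightarrow> 'a \<Rightarrow> 'a"
  assumes assoc: "\<lbrakk>x \<in> topspace X; y \<in> topspace X; z \<in> topspace X\<rbrakk> \<Longrightarrow> m (m x y) z = m x (m y z)"
    and continuous_mult: "continuous_map (prod_topology X X) X (\<lambda>(x, y). m x y)"

definition commutative_on :: "'a set \<Rightarrow> ('a \<Rightarrow> 'a \<Rightarrow> 'a) \<Rightarrow> bool" where
  "commutative_on S m \<longleftrightarrow> (\<forall>x\<in>S. \<forall>y\<in>S. m x y = m y x)"

definition cancellative_on :: "'a set \<Rightarrow> ('a \<Rightarrow> 'a \<Rightarrow> 'a) \<Rightarrow> bool" where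
  "cancellative_on S m \<longleftrightarrow>
     (\<forall>a\<in>S. \<forall>x\<in>S. \<forall>y\<in>S. (m a x = m a y \<longrightarrow> x = y) \<and> (m x a = m y a \<longrightarrow> x = y))"

definition open_shifts :: "'a topology \<Rightarrow> ('a \<Rightarrow> 'a \<Rightarrow> 'a) \<Rightarrow> bool" where
  "open_shifts X m \<longleftrightarrow> (\<forall>a\<in>topspace X. open_map X X (\<lambda>x. m a x))"

definition pseudocompact_space :: "'a topology \<Rightarrow> bool" where
  "pseudocompact_space X \<longleftrightarrow>
     (\<forall>f. continuous_map X euclideanreal f \<longrightarrow> bounded (f ` topspace X))"

locale topological_group = group G for G (structure) +
  fixes X :: "'a topology"
  assumes topspace_eq: "topspace X = carrier G"
    and continuous_mult: "continuous_map (prod_topology X X) X (\<lambda>(x, y). x \<otimes> y)"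
    and continuous_inv: "continuous_map X X (\<lambda>x. inv x)"

end

theory Submission
  imports Defs
begin

text \<open>
  Throughout, \<open>a x / z\<close> stands for the solution \<open>s\<close> of \<open>a x = z s\<close>, which is unique if it exists.
  In the group of fractions of the semigroup, continuity of inversion would say that
  \<open>a z' / z\<close> is close to \<open>a\<close> once \<open>z\<close> and \<open>z'\<close> are close to the same point. This can be stated,
  and proved, without leaving the semigroup (\<open>quotient_nbhd_uniform\<close>); the asserted
  existence of the quotient inside the semigroup is what replaces inverses.

  Its proof is Ellis' argument for locally compact groups. If the quotients \<open>a y / z\<close> do not exist
  near \<open>a\<close>, there are points \<open>y\<^sub>0, y\<^sub>1, \<dots>\<close>, each very close to its predecessor, such that
  \<open>a y\<^sub>n / y\<^sub>n\<^sub>+\<^sub>1\<close> is always bad, while all the quotients \<open>a y\<^sub>n / y\<^sub>i\<close> with \<open>i \<le> n\<close> lie in one small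
  compact neighbourhood \<open>B\<close> of \<open>a\<close>. A cluster point of the \<open>y\<^sub>n a\<close> is close to \<open>y\<^sub>n a\<close> for some \<open>n\<close>
  and lies in \<open>y\<^sub>n\<^sub>+\<^sub>1 B\<close>, so the quotient \<open>a y\<^sub>n / y\<^sub>n\<^sub>+\<^sub>1\<close> is good after all (\<open>quotient_nbhd\<close>).

  Pseudocompactness is used in the form that every sequence of nonempty open sets accumulates at
  some point (\<open>pseudocompact_accumulation\<close>). Apply this to the sets \<open>a\<^sup>n V\<close>, with \<open>V\<close> a small open
  set: for some \<open>n\<close> and some much larger \<open>k\<close>, both \<open>a\<^sup>n V\<close> and \<open>a\<^sup>k V\<close> come near the same point \<open>x\<close>.
  So \<open>a\<^sup>k\<^sup>-\<^sup>n\<close> is almost the identity, and dividing out what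
  separates it from the identity costs only two factors \<open>a\<close>. What is left is an equation
  \<open>z = z (a r)\<close>, and by cancellation \<open>a r\<close> is an identity element (\<open>local_unit\<close>,
  \<open>ex_group\<close>). Hence the semigroup is a group, and its inversion is continuous by the
  neighbourhood lemma. Finally, if no finitely many translates of a compact neighbourhood of the
  identity cover the group, then there are translates \<open>y\<^sub>n V\<close> of a small open set that do not
  accumulate anywhere; this gives compactness (\<open>compact_if_unit\<close>).
\<close>

section \<open>Accumulation of open sets and of points\<close>

text \<open>
  The index set of the sum depends on the point. Near a given point it may be replaced by the fixed
  finite set of all indices \<open>n\<close> for which \<open>U n\<close> meets a neighbourhood of that point.
\<close>
lemma continuous_map_locally_finite_sum:
  fixes g :: "nat \<Rightarrow> 'a \<Rightarrow> real"
  assumes cont: "\<And>n. continuous_map X euclideanreal (g n)"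
    and supp: "\<And>n x. x \<in> topspace X \<Longrightarrow> x \<notin> U n \<Longrightarrow> g n x = 0"
    and lf: "\<And>x. x \<in> topspace X \<Longrightarrow> \<exists>N. openin X N \<and> x \<in> N \<and> finite {n. U n \<inter> N \<noteq> {}}"
  shows "continuous_map X euclideanreal (\<lambda>x. \<Sum>n | x \<in> U n. g n x)"
proof -
  from lf obtain N where N: "\<And>x. x \<in> topspace X \<Longrightarrow> openin X (N x)"
      "\<And>x. x \<in> topspace X \<Longrightarrow> x \<in> N x"
      "\<And>x. x \<in> topspace X \<Longrightarrow> finite {n. U n \<inter> N x \<noteq> {}}"
    by metis
  have eq: "(\<Sum>n | U n \<inter> N x \<noteq> {}. g n y) = (\<Sum>n | y \<in> U n. g n y)"
    if "x \<in> topspace X" "y \<in> N x" for x y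
  proof (rule sum.mono_neutral_right)
    show "finite {n. U n \<inter> N x \<noteq> {}}" using N(3) that(1) .
    show "{n. y \<in> U n} \<subseteq> {n. U n \<inter> N x \<noteq> {}}" using that(2) by blast
    show "\<forall>n\<in>{n. U n \<inter> N x \<noteq> {}} - {n. y \<in> U n}. g n y = 0"
      using supp openin_subset[OF N(1)[OF that(1)]] that(2) by blast
  qed
  show ?thesis
  proof (rule pasting_lemma[where I = "topspace X" and T = N
        and f = "\<lambda>x y. \<Sum>n | U n \<inter> N x \<noteq> {}. g n y"])
    show "continuous_map (subtopology X (N x)) euclideanreal (\<lambda>y. \<Sum>n | U n \<inter> N x \<noteq> {}. g n y)"
      if "x \<in> topspace X" for x
      using N(3)[OF that] cont
      by (intro continuous_map_sum continuous_map_from_subtopology) auto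
  qed (use N eq in auto)
qed

text \<open>
  If the sets \<open>U n\<close> did not accumulate, they would be locally finite, and bumps of height \<open>n\<close>
  supported in \<open>U n\<close> would add up to an unbounded continuous function.
\<close>
lemma pseudocompact_accumulation:
  assumes cr: "completely_regular_space X" and pc: "pseudocompact_space X"
    and op: "\<And>n::nat. openin X (U n)" and ne: "\<And>n. U n \<noteq> {}"
  obtains x where "x \<in> topspace X"
    and "\<And>N. openin X N \<Longrightarrow> x \<in> N \<Longrightarrow> infinite {n. U n \<inter> N \<noteq> {}}"
proof -
  have "\<exists>x\<in>topspace X. \<forall>N. openin X N \<longrightarrow> x \<in> N \<longrightarrow> infinite {n. U n \<inter> N \<noteq> {}}"
  proof (rule ccontr)
    assume "\<not> ?thesis"
    then have lf: "\<exists>N. openin X N \<and> x \<in> N \<and> finite {n. U n \<inter> N \<noteq> {}}"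
      if "x \<in> topspace X" for x using that by blast
    have "\<forall>n. \<exists>w. w \<in> U n" using ne by blast
    then obtain w where w: "\<And>n. w n \<in> U n" by metis
    have wS: "w n \<in> topspace X" for n using w op openin_subset by blast
    have "\<exists>f::'a\<Rightarrow>real. continuous_map X (top_of_set {0..1}) f \<and> f (w n) = 0 \<and>
        f ` (topspace X - U n) \<subseteq> {1}" for n
      using cr[unfolded completely_regular_space_def, rule_format, of "topspace X - U n" "w n"]
        op w wS by blast
    then obtain f :: "nat \<Rightarrow> 'a \<Rightarrow> real" where f: "\<And>n. continuous_map X (top_of_set {0..1}) (f n)"
        "\<And>n. f n (w n) = 0" "\<And>n. f n ` (topspace X - U n) \<subseteq> {1}" by metis
    have fc: "continuous_map X euclideanreal (f n)" for n
      using f(1) continuous_map_into_fulltopology by blast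
    have f01: "f n x \<le> 1" if "x \<in> topspace X" for n x
      using f(1)[of n] that by (auto simp: continuous_map_in_subtopology)
    define g where "g n x = real n * (1 - f n x)" for n x
    let ?h = "\<lambda>x. \<Sum>n | x \<in> U n. g n x"
    have "continuous_map X euclideanreal ?h"
    proof (rule continuous_map_locally_finite_sum)
      show "continuous_map X euclideanreal (g n)" for n
        unfolding g_def by (intro continuous_intros fc) auto
      show "g n x = 0" if "x \<in> topspace X" "x \<notin> U n" for n x
        using f(3)[of n] that by (auto simp: g_def)
    qed (use lf in auto)
    then have "bounded (?h ` topspace X)" using pc by (simp add: pseudocompact_space_def)
    then obtain B where B: "\<And>x. x \<in> topspace X \<Longrightarrow> \<bar>?h x\<bar> \<le> B"
      by (auto simp: bounded_iff)
    have "real n \<le> B" for n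
    proof -
      obtain N where "w n \<in> N" "finite {k. U k \<inter> N \<noteq> {}}" using lf[OF wS] by blast
      then have fin: "finite {k. w n \<in> U k}" 
        by (elim finite_subset[rotated]) blast
      have "real n = g n (w n)" using f(2) by (simp add: g_def)
      also have "\<dots> \<le> ?h (w n)"
        using fin w f01 wS by (intro member_le_sum) (auto simp: g_def)
      also have "\<dots> \<le> B" using B[OF wS] by (simp add: abs_le_iff)
      finally show ?thesis .
    qed
    then show False using reals_Archimedean2 by (metis not_le)
  qed
  then show thesis using that by blast
qed

lemma compactin_sequence_cluster_point:
  assumes K: "compactin X K" and s: "\<And>n::nat. s n \<in> K"
  obtains u where "u \<in> K" and "\<And>N. openin X N \<Longrightarrow> u \<in> N \<Longrightarrow> infinite {n. s n \<in> N}"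
proof -
  have "\<exists>u\<in>K. \<forall>N. openin X N \<longrightarrow> u \<in> N \<longrightarrow> infinite {n. s n \<in> N}"
  proof (rule ccontr)
    assume "\<not> ?thesis"
    then obtain N where N: "\<And>u. u \<in> K \<Longrightarrow> openin X (N u) \<and> u \<in> N u \<and> finite {n. s n \<in> N u}"
      by metis
    then have "\<forall>V \<in> N ` K. openin X V" "K \<subseteq> \<Union> (N ` K)" by auto
    with K obtain F where F: "finite F" "F \<subseteq> N ` K" "K \<subseteq> \<Union> F"
      unfolding compactin_def by meson
    have "finite (\<Union>V\<in>F. {n. s n \<in> V})" using F(1,2) N by auto
    moreover have "(\<Union>V\<in>F. {n. s n \<in> V}) = UNIV" using F(3) s by blast
    ultimately show False by simp
  qed
  then show thesis using that by blast
qed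

section \<open>Division in a commutative cancellative semigroup with open shifts\<close>

locale open_shift_semigroup = topological_semigroup X m
  for X :: "'a topology" and m (infixl "\<cdot>" 70) +
  assumes comm: "\<lbrakk>x \<in> topspace X; y \<in> topspace X\<rbrakk> \<Longrightarrow> x \<cdot> y = y \<cdot> x"
    and cancel: "\<lbrakk>a \<in> topspace X; x \<in> topspace X; y \<in> topspace X; a \<cdot> x = a \<cdot> y\<rbrakk> \<Longrightarrow> x = y"
    and open_shift: "\<lbrakk>a \<in> topspace X; openin X U\<rbrakk> \<Longrightarrow> openin X (m a ` U)"
begin

abbreviation S where "S \<equiv> topspace X"

lemma mult_closed [simp, intro]: "x \<in> S \<Longrightarrow> y \<in> S \<Longrightarrow> x \<cdot> y \<in> S"
  using continuous_mult by (force simp: continuous_map_def)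

lemma lcomm: "\<lbrakk>x \<in> S; y \<in> S; z \<in> S\<rbrakk> \<Longrightarrow> x \<cdot> (y \<cdot> z) = y \<cdot> (x \<cdot> z)"
  by (metis assoc comm)

lemmas ac = assoc comm lcomm

lemma cancel_right: "\<lbrakk>a \<in> S; x \<in> S; y \<in> S; x \<cdot> a = y \<cdot> a\<rbrakk> \<Longrightarrow> x = y"
  by (metis comm cancel)

lemma mult_nbhds:
  assumes "openin X W" "x \<in> S" "y \<in> S" "x \<cdot> y \<in> W"
  obtains U V where "openin X U" "openin X V" "x \<in> U" "y \<in> V"
    "\<forall>u\<in>U. \<forall>v\<in>V. u \<cdot> v \<in> W"
proof -
  let ?P = "{p \<in> topspace (prod_topology X X). (\<lambda>(x, y). x \<cdot> y) p \<in> W}"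
  have "openin (prod_topology X X) ?P"
    using continuous_mult assms(1) by (rule openin_continuous_map_preimage)
  then have *: "\<forall>x y. (x, y) \<in> ?P \<longrightarrow> (\<exists>U V. openin X U \<and> openin X V \<and> x \<in> U \<and> y \<in> V \<and> U \<times> V \<subseteq> ?P)"
    unfolding openin_prod_topology_alt .
  have "(x, y) \<in> ?P" using assms by simp
  from *[rule_format, OF this] obtain U V
    where UV: "openin X U" "openin X V" "x \<in> U" "y \<in> V" "U \<times> V \<subseteq> ?P" by blast
  show thesis by (rule that[OF UV(1-4)]) (use UV(5) in auto)
qed

lemma continuous_map_shift:
  assumes a: "a \<in> S" shows "continuous_map X X (\<lambda>z. z \<cdot> a)"
proof -
  have "continuous_map X (prod_topology X X) (\<lambda>z. (z, a))"
    using a by (intro continuous_map_pairedI) auto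
  from continuous_map_compose[OF this continuous_mult] show ?thesis by (simp add: o_def)
qed

lemma open_shift_preimage:
  "a \<in> S \<Longrightarrow> openin X W \<Longrightarrow> openin X {z \<in> S. z \<cdot> a \<in> W}"
  using openin_continuous_map_preimage[OF continuous_map_shift] by blast

text \<open>
  Translation by \<open>x / y\<close> in the group of fractions, expressed without that group: a
  neighbourhood of \<open>y\<close> on which the quotients \<open>a y / z\<close> exist and lie in \<open>A\<close> yields such a
  neighbourhood of every other point. The proof below of \<open>quotient_nbhd\<close> needs this to carry a failure at
  one point along a sequence of points.
\<close>
lemma quotient_nbhd_transfer:
  assumes x: "x \<in> S" and y: "y \<in> S" and a: "a \<in> S" and A: "openin X A"
    and V: "openin X V" "y \<in> V" "\<And>z. z \<in> V \<Longrightarrow> a \<cdot> y \<in> m z ` A"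
  shows "\<exists>V'. openin X V' \<and> x \<in> V' \<and> (\<forall>z\<in>V'. a \<cdot> x \<in> m z ` A)"
proof (intro exI conjI ballI)
  let ?V = "{z \<in> S. z \<cdot> y \<in> m x ` V}"
  show "openin X ?V" by (intro open_shift_preimage open_shift x y V)
  show "x \<in> ?V" using x V(2) by auto
  fix z assume "z \<in> ?V"
  then obtain v where z: "z \<in> S" and v: "v \<in> V" "z \<cdot> y = x \<cdot> v" by auto
  from V(3)[OF v(1)] obtain s where s: "s \<in> A" "a \<cdot> y = v \<cdot> s" by auto
  have vS: "v \<in> S" and sS: "s \<in> S" using v(1) V(1) s(1) A openin_subset by blast+
  have "y \<cdot> (z \<cdot> s) = (z \<cdot> y) \<cdot> s" using y z sS by (simp add: ac)
  also have "\<dots> = x \<cdot> (a \<cdot> y)" using v(2) s(2) x vS sS by (simp add: assoc)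
  also have "\<dots> = y \<cdot> (a \<cdot> x)" using x y a by (simp add: ac)
  finally have "z \<cdot> s = a \<cdot> x" using cancel y z sS a x by blast
  then show "a \<cdot> x \<in> m z ` A" using s(1) by force
qed

end

locale locally_compact_open_shift_semigroup = open_shift_semigroup +
  assumes hausdorff: "Hausdorff_space X" and locally_compact: "locally_compact_space X"
begin

lemma compact_nbhd:
  assumes "openin X W" "x \<in> W"
  obtains U K where "openin X U" "compactin X K" "x \<in> U" "U \<subseteq> K" "K \<subseteq> W"
  using locally_compact hausdorff assms
  by (metis locally_compact_space_neighbourhood_base neighbourhood_base_of)

lemma compactin_shift:
  assumes "a \<in> S" "compactin X K" shows "compactin X (m a ` K)"
proof -
  have "compactin X ((\<lambda>z. z \<cdot> a) ` K)"
    using assms continuous_map_shift image_compactin by blast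
  moreover have "(\<lambda>z. z \<cdot> a) ` K = m a ` K"
    using assms(1) compactin_subset_topspace[OF assms(2)] by (intro image_cong) (auto intro: comm)
  ultimately show ?thesis by simp
qed

text \<open>
  Ellis' argument: the cluster point \<open>u\<close> of the points \<open>y n \<cdot> a\<close> links \<open>y n\<close> with \<open>y (Suc n)\<close>.
  In terms of fractions, \<open>y n / y (Suc n)\<close> is \<open>(y n \<cdot> a / u) (u / (y (Suc n) \<cdot> a))\<close>,
  where the first factor is near 1 for some \<open>n\<close> because \<open>u\<close> is a cluster point, and the second for
  every \<open>n\<close> because all but finitely many of the points lie in the compact, hence closed, set \<open>y (Suc n) B\<close>.
\<close>
lemma quotient_nbhd:
  assumes x: "x \<in> S" and A: "openin X A" "a \<in> A"
  shows "\<exists>V. openin X V \<and> x \<in> V \<and> (\<forall>z\<in>V. a \<cdot> x \<in> m z ` A)"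
proof (rule ccontr)
  assume neg: "\<not> ?thesis"
  have AS: "A \<subseteq> S" and a: "a \<in> S" using A openin_subset by blast+
  have fails: "\<exists>z\<in>V. a \<cdot> y \<notin> m z ` A" if "y \<in> S" "openin X V" "y \<in> V" for y V
    using quotient_nbhd_transfer[OF x that(1) a A(1) that(2,3)] neg by blast
  \<comment> \<open>\<open>B\<close> is so small that \<open>B \<cdot> D \<cdot> a\<close> lies in the open set \<open>(a \<cdot> a) A\<close>. The two
    factors \<open>a\<close> turn the ratios \<open>y n \<cdot> a / u\<close> and \<open>u / (y (Suc n) \<cdot> a)\<close>, which are near 1 and need not
    lie in the semigroup, into elements \<open>\<delta>\<close> and \<open>\<beta>\<close> of it near \<open>a\<close>.\<close>
  have op: "openin X {z \<in> S. z \<cdot> a \<in> m (a \<cdot> a) ` A}"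
    by (intro open_shift_preimage open_shift a A mult_closed)
  have mem: "a \<cdot> a \<in> {z \<in> S. z \<cdot> a \<in> m (a \<cdot> a) ` A}" using a A(2) by simp
  obtain W1 W2 where W: "openin X W1" "openin X W2" "a \<in> W1" "a \<in> W2"
      "\<forall>u\<in>W1. \<forall>v\<in>W2. u \<cdot> v \<in> {z \<in> S. z \<cdot> a \<in> m (a \<cdot> a) ` A}"
    by (rule mult_nbhds[OF op a a mem])
  obtain D B where B: "openin X D" "compactin X B" "a \<in> D" "D \<subseteq> B" "B \<subseteq> W1 \<inter> W2"
    by (rule compact_nbhd[OF openin_Int[OF W(1,2)] IntI[OF W(3,4)]])
  have BS: "B \<subseteq> S" using B(2) compactin_subset_topspace by blast
  \<comment> \<open>Each of the conditions on \<open>y n\<close> with \<open>i < n\<close> is open and already holds at \<open>y (n - 1)\<close>, so a bad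
    point sufficiently close to \<open>y (n - 1)\<close> satisfies them all.\<close>
  have "\<exists>y. \<forall>n::nat. y n \<in> S \<and> (\<forall>i<n. y n \<cdot> a \<in> m (y i) ` D) \<and> (n > 0 \<longrightarrow> a \<cdot> y (n - 1) \<notin> m (y n) ` A)"
  proof (rule dependent_wellorder_choice[where P = "\<lambda>y n r. r \<in> S \<and> (\<forall>i<n. r \<cdot> a \<in> m (y i) ` D) \<and>
        (n > 0 \<longrightarrow> a \<cdot> y (n - 1) \<notin> m r ` A)"])
    fix n :: nat and y
    assume IH: "\<And>k. k < n \<Longrightarrow> y k \<in> S \<and> (\<forall>i<k. y k \<cdot> a \<in> m (y i) ` D) \<and> (k > 0 \<longrightarrow> a \<cdot> y (k - 1) \<notin> m (y k) ` A)"
    show "\<exists>r. r \<in> S \<and> (\<forall>i<n. r \<cdot> a \<in> m (y i) ` D) \<and> (n > 0 \<longrightarrow> a \<cdot> y (n - 1) \<notin> m r ` A)"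
    proof (cases n)
      case 0 then show ?thesis using x by auto
    next
      case (Suc k)
      define V where "V = S \<inter> (\<Inter>i\<in>{..k}. {z \<in> S. z \<cdot> a \<in> m (y i) ` D})"
      have "openin X V" unfolding V_def
        using IH Suc by (intro openin_Int_Inter) (auto intro!: open_shift_preimage open_shift a B)
      moreover have yk: "y k \<in> S" using IH[of k] Suc by simp
      moreover have "y k \<cdot> a \<in> m (y i) ` D" if "i \<le> k" for i
        using that IH[of k] Suc B(3) by (cases "i = k") auto
      then have "y k \<in> V" using yk by (simp add: V_def)
      ultimately obtain r where "r \<in> V" "a \<cdot> y k \<notin> m r ` A"
        using fails by meson
      then show ?thesis using Suc unfolding V_def by (auto simp: less_Suc_eq_le)
    qed
  qed auto
  then obtain y where y: "\<And>n. y n \<in> S" "\<And>i n. i < n \<Longrightarrow> y n \<cdot> a \<in> m (y i) ` D"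
      "\<And>n. a \<cdot> y n \<notin> m (y (Suc n)) ` A"
    by (metis diff_Suc_1 zero_less_Suc)
  have tail: "y n \<cdot> a \<in> m (y i) ` B" if "i \<le> n" for i n
    using that y(2)[of i n] B(3,4) by (cases "i = n") auto
  obtain u where u: "u \<in> m (y 0) ` B" and cl: "\<And>N. openin X N \<Longrightarrow> u \<in> N \<Longrightarrow> infinite {n. y n \<cdot> a \<in> N}"
    using compactin_sequence_cluster_point[of X "m (y 0) ` B" "\<lambda>n. y n \<cdot> a"] compactin_shift y(1) B(2) tail
    by (metis le0)
  have uS: "u \<in> S" using u y(1) BS by auto
  have uB: "u \<in> m (y i) ` B" for i
  proof (rule ccontr)
    assume "u \<notin> m (y i) ` B"
    moreover have "closedin X (m (y i) ` B)"
      using compactin_imp_closedin hausdorff compactin_shift y(1) B(2) by blast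
    ultimately have "infinite {n. y n \<cdot> a \<in> S - m (y i) ` B}" using cl uS by blast
    then obtain n where "i < n" "y n \<cdot> a \<in> S - m (y i) ` B"
      unfolding infinite_nat_iff_unbounded by blast
    then show False using tail[of i n] by simp
  qed
  have "infinite {n. y n \<cdot> a \<in> {z \<in> S. z \<cdot> a \<in> m u ` D}}"
    using B(3) uS by (intro cl open_shift_preimage open_shift a B(1)) auto
  then obtain n where "y n \<cdot> a \<in> {z \<in> S. z \<cdot> a \<in> m u ` D}"
    using not_finite_existsD by blast
  then obtain \<delta> where \<delta>: "\<delta> \<in> D" "y n \<cdot> a \<cdot> a = u \<cdot> \<delta>" by auto
  obtain \<beta> where \<beta>: "\<beta> \<in> B" "u = y (Suc n) \<cdot> \<beta>" using uB by blast
  have "\<beta> \<cdot> \<delta> \<in> {z \<in> S. z \<cdot> a \<in> m (a \<cdot> a) ` A}" using W(5) \<beta>(1) \<delta>(1) B(4,5) by blast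
  then obtain \<alpha> where \<alpha>: "\<alpha> \<in> A" "\<beta> \<cdot> \<delta> \<cdot> a = a \<cdot> a \<cdot> \<alpha>" by auto
  have mem: "y n \<in> S" "y (Suc n) \<in> S" "\<alpha> \<in> S" "\<beta> \<in> S" "\<delta> \<in> S"
    using y(1) \<alpha>(1) AS \<beta>(1) \<delta>(1) BS B(4) by auto
  have "(a \<cdot> a) \<cdot> (a \<cdot> y n) = (y n \<cdot> a \<cdot> a) \<cdot> a" using mem a by (simp add: ac)
  also have "\<dots> = y (Suc n) \<cdot> (\<beta> \<cdot> \<delta> \<cdot> a)" unfolding \<delta>(2) \<beta>(2) using mem a by (simp add: assoc)
  also have "\<dots> = (a \<cdot> a) \<cdot> (y (Suc n) \<cdot> \<alpha>)" unfolding \<alpha>(2) using mem a by (simp add: ac)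
  finally have "a \<cdot> y n = y (Suc n) \<cdot> \<alpha>" using cancel mem a by (meson mult_closed)
  then show False using y(3) \<alpha>(1) by blast
qed

text \<open>
  This is the form of division that replaces inverses in what follows. Now both the dividend and
  the divisor vary. Up to a factor \<open>a\<close>, which is cancelled, \<open>a z' / z\<close> is the product of \<open>a x / z\<close>,
  controlled by \<open>quotient_nbhd\<close>, and \<open>z' a / x\<close>, which is near \<open>a\<close> for \<open>z'\<close> near \<open>x\<close> because
  shifts are open.
\<close>
lemma quotient_nbhd_uniform:
  assumes x: "x \<in> S" and A: "openin X A" "a \<in> A"
  obtains V where "openin X V" "x \<in> V" "\<And>z z'. z \<in> V \<Longrightarrow> z' \<in> V \<Longrightarrow> a \<cdot> z' \<in> m z ` A"
proof -
  have AS: "A \<subseteq> S" and a: "a \<in> S" using A openin_subset by blast+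
  have op: "openin X {t \<in> S. t \<cdot> a \<in> m (x \<cdot> a) ` A}"
    by (intro open_shift_preimage open_shift a A mult_closed x)
  have mem: "x \<cdot> a \<in> {t \<in> S. t \<cdot> a \<in> m (x \<cdot> a) ` A}" using a x A(2) by simp
  obtain V1 A1 where V1: "openin X V1" "openin X A1" "x \<in> V1" "a \<in> A1"
      "\<forall>u\<in>V1. \<forall>v\<in>A1. u \<cdot> v \<in> {t \<in> S. t \<cdot> a \<in> m (x \<cdot> a) ` A}"
    by (rule mult_nbhds[OF op x a mem])
  obtain V2 where V2: "openin X V2" "x \<in> V2" "\<And>z. z \<in> V2 \<Longrightarrow> a \<cdot> x \<in> m z ` A1"
    using quotient_nbhd[OF x V1(2,4)] by blast
  show thesis
  proof (rule that[of "V1 \<inter> V2"])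
    fix z z' assume z: "z \<in> V1 \<inter> V2" and z': "z' \<in> V1 \<inter> V2"
    obtain \<alpha> where \<alpha>: "\<alpha> \<in> A1" "a \<cdot> x = z \<cdot> \<alpha>" using V2(3) z by blast
    obtain \<beta> where \<beta>: "\<beta> \<in> A" "z' \<cdot> \<alpha> \<cdot> a = x \<cdot> a \<cdot> \<beta>" using bspec[OF bspec[OF V1(5), of z'] \<alpha>(1)] z' by auto
    have mem: "z \<in> S" "z' \<in> S" "\<alpha> \<in> S" "\<beta> \<in> S"
      using z z' \<alpha>(1) \<beta>(1) AS V1(1,2) openin_subset by blast+
    have "(x \<cdot> a) \<cdot> (a \<cdot> z') = (a \<cdot> x) \<cdot> (z' \<cdot> a)" using mem a x by (simp add: ac)
    also have "\<dots> = z \<cdot> (z' \<cdot> \<alpha> \<cdot> a)" unfolding \<alpha>(2) using mem a by (simp add: ac)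
    also have "\<dots> = (x \<cdot> a) \<cdot> (z \<cdot> \<beta>)" unfolding \<beta>(2) using mem a x by (simp add: ac)
    finally have "a \<cdot> z' = z \<cdot> \<beta>" using cancel mem a x by (meson mult_closed)
    then show "a \<cdot> z' \<in> m z ` A" using \<beta>(1) by blast
  qed (use V1 V2 in auto)
qed

lemma accumulation:
  assumes "pseudocompact_space X" "\<And>n::nat. openin X (U n)" "\<And>n. U n \<noteq> {}"
  obtains x where "x \<in> S" "\<And>N. openin X N \<Longrightarrow> x \<in> N \<Longrightarrow> infinite {n. U n \<inter> N \<noteq> {}}"
proof -
  have "completely_regular_space X"
    using locally_compact_regular_imp_completely_regular_space locally_compact hausdorff by blast
  then show thesis by (rule pseudocompact_accumulation[OF _ assms]) (rule that)
qed

section \<open>The algebraic group\<close>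

lemma funpow_shift_closed: "a \<in> S \<Longrightarrow> x \<in> S \<Longrightarrow> (m a ^^ n) x \<in> S"
  by (induction n) auto

lemma funpow_shift_mult:
  "a \<in> S \<Longrightarrow> x \<in> S \<Longrightarrow> y \<in> S \<Longrightarrow> (m a ^^ n) (x \<cdot> y) = (m a ^^ n) x \<cdot> y"
  by (induction n) (auto simp: assoc funpow_shift_closed)

lemma open_funpow_shift: "a \<in> S \<Longrightarrow> openin X U \<Longrightarrow> openin X ((m a ^^ n) ` U)"
proof (induction n)
  case (Suc n)
  then have "openin X (m a ` (m a ^^ n) ` U)" using open_shift by blast
  then show ?case by (simp add: image_image)
qed simp

text \<open>
  Let \<open>p = a\<^sup>n w\<close> and \<open>p' = a\<^sup>k w'\<close> be near the same point, with \<open>w, w'\<close> in a small set. Then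
  \<open>a\<^sup>k\<^sup>-\<^sup>n p w' = p' w\<close>. Both \<open>a p / p'\<close> and \<open>a w' / w\<close> exist, so \<open>p' w\<close> divides \<open>a\<^sup>2 p w'\<close>.
  For \<open>k - n > 2\<close> this makes \<open>p w'\<close> a multiple of itself by a factor that is divisible by \<open>a\<close>.
  Powers of \<open>a\<close> are written as iterated shifts, since \<open>a\<^sup>0\<close> has no meaning before there is an identity.
\<close>
lemma local_unit:
  assumes pc: "pseudocompact_space X" and a: "a \<in> S"
  obtains z r where "z \<in> S" "r \<in> S" "z = z \<cdot> (a \<cdot> r)"
proof -
  obtain V where V: "openin X V" "a \<in> V" "\<And>z z'. z \<in> V \<Longrightarrow> z' \<in> V \<Longrightarrow> a \<cdot> z' \<in> m z ` S"
    using quotient_nbhd_uniform[of a S a] a by auto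
  obtain x where x: "x \<in> S"
      "\<And>N. openin X N \<Longrightarrow> x \<in> N \<Longrightarrow> infinite {n. (m a ^^ n) ` V \<inter> N \<noteq> {}}"
    using accumulation[OF pc, of "\<lambda>n. (m a ^^ n) ` V"] V(1,2) open_funpow_shift a
    by (metis empty_iff image_is_empty)
  obtain N where N: "openin X N" "x \<in> N" "\<And>z z'. z \<in> N \<Longrightarrow> z' \<in> N \<Longrightarrow> a \<cdot> z' \<in> m z ` S"
    using quotient_nbhd_uniform[of x S a] a x(1) by auto
  have inf: "infinite {n. (m a ^^ n) ` V \<inter> N \<noteq> {}}" using x(2) N(1,2) .
  then obtain n where n: "(m a ^^ n) ` V \<inter> N \<noteq> {}" using not_finite_existsD by blast
  from inf obtain k where k: "n + 2 < k" "(m a ^^ k) ` V \<inter> N \<noteq> {}"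
    unfolding infinite_nat_iff_unbounded by blast
  define j where "j = k - n - 3"
  have kj: "k = (j + 3) + n" using k(1) by (simp add: j_def)
  from n obtain w where w: "w \<in> V" "(m a ^^ n) w \<in> N" by blast
  from k(2) obtain w' where w': "w' \<in> V" "(m a ^^ k) w' \<in> N" by blast
  define p where "p = (m a ^^ n) w"
  define p' where "p' = (m a ^^ k) w'"
  obtain s where s: "s \<in> S" "a \<cdot> p = p' \<cdot> s" using N(3) w w' unfolding p_def p'_def by blast
  obtain t where t: "t \<in> S" "a \<cdot> w' = w \<cdot> t" using V(3) w w' by blast
  have mem: "w \<in> S" "w' \<in> S" "p \<in> S" "p' \<in> S"
    using V(1) N(1) w w' openin_subset unfolding p_def p'_def by blast+
  define r where "r = (m a ^^ j) (s \<cdot> t)"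
  have r: "r \<in> S" using s t a by (simp add: r_def funpow_shift_closed)
  have cross: "p' \<cdot> w = (m a ^^ (j + 3)) (p \<cdot> w')"
  proof -
    have "p' \<cdot> w = (m a ^^ k) (w' \<cdot> w)" using mem a by (simp add: p'_def funpow_shift_mult)
    also have "w' \<cdot> w = w \<cdot> w'" using mem by (simp add: comm)
    also have "(m a ^^ k) \<dots> = (m a ^^ (j + 3)) ((m a ^^ n) (w \<cdot> w'))"
      by (simp add: kj funpow_add)
    finally show ?thesis using mem a by (simp add: funpow_shift_mult p_def)
  qed
  define z where "z = p \<cdot> w'"
  have zS: "z \<in> S" using mem by (simp add: z_def)
  have "(a \<cdot> a) \<cdot> z = (a \<cdot> p) \<cdot> (a \<cdot> w')" using mem a by (simp add: ac z_def)
  also have "\<dots> = (p' \<cdot> w) \<cdot> (s \<cdot> t)" unfolding s(2) t(2) using mem s t by (simp add: ac)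
  also have "\<dots> = (m a ^^ (3 + j)) (z \<cdot> (s \<cdot> t))" 
    unfolding cross using zS s t a by (simp add: funpow_shift_mult add.commute flip: z_def)
  also have "\<dots> = (m a ^^ 3) ((m a ^^ j) ((s \<cdot> t) \<cdot> z))"
    using comm[OF zS, of "s \<cdot> t"] s t by (simp add: funpow_add)
  also have "\<dots> = (m a ^^ 3) (r \<cdot> z)"
    using zS s t a by (simp add: funpow_shift_mult r_def)
  also have "\<dots> = (a \<cdot> a) \<cdot> (z \<cdot> (a \<cdot> r))"
    using zS r a by (simp add: numeral_3_eq_3 ac)
  finally have "z = z \<cdot> (a \<cdot> r)" using cancel[of "a \<cdot> a"] zS r a by (meson mult_closed)
  then show thesis using that zS r by blast
qed

lemma unit_from_local_unit:
  assumes "z \<in> S" "e \<in> S" "z = z \<cdot> e" "y \<in> S"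
  shows "e \<cdot> y = y"
  using assms cancel[of z "e \<cdot> y" y] by (metis assoc mult_closed)

lemma ex_group:
  assumes "pseudocompact_space X" "S \<noteq> {}"
  obtains e where "group \<lparr>carrier = S, mult = m, one = e\<rparr>"
proof -
  have inv: "\<exists>r\<in>S. \<forall>y\<in>S. (a \<cdot> r) \<cdot> y = y" if a: "a \<in> S" for a
  proof -
    obtain z r where "z \<in> S" "r \<in> S" "z = z \<cdot> (a \<cdot> r)" using assms(1) a by (rule local_unit)
    then show ?thesis using unit_from_local_unit[of z "a \<cdot> r"] a by blast
  qed
  obtain e where e: "e \<in> S" "\<And>y. y \<in> S \<Longrightarrow> e \<cdot> y = y"
  proof -
    obtain a where a: "a \<in> S" using assms(2) by blast
    then obtain r where "r \<in> S" "\<forall>y\<in>S. (a \<cdot> r) \<cdot> y = y" using inv by blast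
    then show thesis using that[of "a \<cdot> r"] a by simp
  qed
  have "group \<lparr>carrier = S, mult = m, one = e\<rparr>"
  proof (rule groupI)
    fix a assume "a \<in> carrier \<lparr>carrier = S, mult = m, one = e\<rparr>"
    then have a: "a \<in> S" by simp
    then obtain r where r: "r \<in> S" "(a \<cdot> r) \<cdot> e = e" using inv e(1) by blast
    then have "r \<cdot> a = e" using e a by (metis comm mult_closed)
    then show "\<exists>y\<in>carrier \<lparr>carrier = S, mult = m, one = e\<rparr>.
        y \<otimes>\<^bsub>\<lparr>carrier = S, mult = m, one = e\<rparr>\<^esub> a = \<one>\<^bsub>\<lparr>carrier = S, mult = m, one = e\<rparr>\<^esub>"
      using r(1) by auto
  qed (use e assoc in auto)
  then show thesis by (rule that)
qed

section \<open>The topological group\<close>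

text \<open>
  With dividend \<open>inv x \<cdot> x\<close>, which is the identity, \<open>quotient_nbhd_uniform\<close> states exactly that
  \<open>inv z\<close> is near \<open>inv x\<close> for \<open>z\<close> near \<open>x\<close>.
\<close>
lemma topological_group_if_group:
  assumes "group \<lparr>carrier = S, mult = m, one = e\<rparr>"
  shows "topological_group \<lparr>carrier = S, mult = m, one = e\<rparr> X"
proof -
  interpret G: group "\<lparr>carrier = S, mult = m, one = e\<rparr>" by fact
  let ?inv = "m_inv \<lparr>carrier = S, mult = m, one = e\<rparr>"
  have "continuous_map X X ?inv"
    unfolding continuous_map_eq_topcontinuous_at topcontinuous_at_def
  proof (intro ballI conjI allI impI)
    show "?inv \<in> S \<rightarrow> S" using G.inv_closed by auto
    fix x A assume x: "x \<in> S" and A: "openin X A \<and> ?inv x \<in> A"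
    obtain V where V: "openin X V" "x \<in> V"
        "\<And>z z'. z \<in> V \<Longrightarrow> z' \<in> V \<Longrightarrow> ?inv x \<cdot> z' \<in> m z ` A"
      using quotient_nbhd_uniform[OF x] A by metis
    have "?inv z \<in> A" if z: "z \<in> V" for z
    proof -
      have zS: "z \<in> S" using z V(1) openin_subset by blast
      obtain \<alpha> where \<alpha>: "\<alpha> \<in> A" "?inv x \<cdot> x = z \<cdot> \<alpha>" using V(3)[OF z V(2)] by blast
      have "\<alpha> \<in> S" using \<alpha>(1) A openin_subset by blast
      moreover have "\<alpha> \<cdot> z = e" using G.l_inv[of x] x \<alpha>(2) comm[OF zS \<open>\<alpha> \<in> S\<close>] by simp
      ultimately have "?inv z = \<alpha>" using G.inv_equality[of \<alpha> z] zS by simp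
      then show ?thesis using \<alpha>(1) by simp
    qed
    then show "\<exists>U. openin X U \<and> x \<in> U \<and> (\<forall>y\<in>U. ?inv y \<in> A)" using V(1,2) by blast
  qed
  then show ?thesis
    using continuous_mult by unfold_locales auto
qed

text \<open>
  Otherwise choose \<open>y n\<close> outside all earlier translates \<open>y i K\<close> of a compact neighbourhood \<open>K\<close> of
  the identity. If \<open>y n V\<close> and \<open>y k V\<close> both meet \<open>x V\<close>, then \<open>y k\<close> differs from \<open>y n\<close> by two quotients
  of elements of \<open>V\<close>, so it lies in \<open>y n K\<close> when \<open>V\<close> is small.
\<close>
lemma compact_if_unit:
  assumes pc: "pseudocompact_space X" and e: "e \<in> S" "\<And>y. y \<in> S \<Longrightarrow> e \<cdot> y = y"
  shows "compact_space X"
proof (rule ccontr)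
  assume nc: "\<not> compact_space X"
  have e': "y \<cdot> e = y" if "y \<in> S" for y using that e comm by metis
  obtain D K where K: "openin X D" "compactin X K" "e \<in> D" "D \<subseteq> K"
    using compact_nbhd[OF openin_topspace e(1)] by metis
  have no_cover: "\<exists>r\<in>S. \<forall>p\<in>P. r \<notin> m p ` K" if P: "finite P" "P \<subseteq> S" for P
  proof (rule ccontr)
    assume "\<not> ?thesis"
    moreover have "(\<Union>p\<in>P. m p ` K) \<subseteq> S"
      using P(2) compactin_subset_topspace[OF K(2)] by auto
    ultimately have "(\<Union>p\<in>P. m p ` K) = S" by blast
    moreover have "compactin X (\<Union>p\<in>P. m p ` K)"
      using P compactin_shift K(2) by (intro compactin_Union) auto
    ultimately show False using nc by (simp add: compact_space_def)
  qed
  have "\<exists>y. \<forall>n::nat. y n \<in> S \<and> (\<forall>i<n. y n \<notin> m (y i) ` K)"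
  proof (rule dependent_wellorder_choice[where P = "\<lambda>y n r. r \<in> S \<and> (\<forall>i<n. r \<notin> m (y i) ` K)"])
    fix n :: nat and y assume "\<And>k. k < n \<Longrightarrow> y k \<in> S \<and> (\<forall>i<k. y k \<notin> m (y i) ` K)"
    then show "\<exists>r. r \<in> S \<and> (\<forall>i<n. r \<notin> m (y i) ` K)"
      using no_cover[of "y ` {..<n}"] by blast
  qed auto
  then obtain y where y: "\<And>n::nat. y n \<in> S" "\<And>i n. i < n \<Longrightarrow> y n \<notin> m (y i) ` K" by blast
  obtain N1 N2 where N: "openin X N1" "openin X N2" "e \<in> N1" "e \<in> N2"
      "\<forall>u\<in>N1. \<forall>v\<in>N2. u \<cdot> v \<in> D"
    using mult_nbhds[OF K(1) e(1) e(1)] e K(3) by metis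
  have N12: "openin X (N1 \<inter> N2)" "e \<in> N1 \<inter> N2" using N by auto
  obtain V where V: "openin X V" "e \<in> V" "\<And>z z'. z \<in> V \<Longrightarrow> z' \<in> V \<Longrightarrow> e \<cdot> z' \<in> m z ` (N1 \<inter> N2)"
    using quotient_nbhd_uniform[OF e(1) N12] by blast
  have VS: "V \<subseteq> S" using V(1) openin_subset by blast
  have quot: "\<exists>q\<in>N1 \<inter> N2. z' = z \<cdot> q" if "z \<in> V" "z' \<in> V" for z z'
  proof -
    have "e \<cdot> z' = z'" using e(2) that(2) VS by blast
    then show ?thesis using V(3)[OF that] by auto
  qed
  obtain x where x: "x \<in> S"
      "\<And>N. openin X N \<Longrightarrow> x \<in> N \<Longrightarrow> infinite {n. m (y n) ` V \<inter> N \<noteq> {}}"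
    using accumulation[OF pc, of "\<lambda>n. m (y n) ` V"] V(1,2) open_shift y(1)
    by (metis empty_iff image_is_empty)
  have inf: "infinite {n. m (y n) ` V \<inter> m x ` V \<noteq> {}}"
    using x(1) V(1,2) e' by (intro x(2) open_shift) (auto intro: image_eqI[of _ _ e])
  then obtain n where n: "m (y n) ` V \<inter> m x ` V \<noteq> {}" using not_finite_existsD by blast
  from inf obtain k where k: "n < k" "m (y k) ` V \<inter> m x ` V \<noteq> {}"
    unfolding infinite_nat_iff_unbounded by blast
  have N12S: "N1 \<inter> N2 \<subseteq> S" using N12(1) openin_subset by blast
  from n obtain u u' where u: "u \<in> V" "u' \<in> V" "y n \<cdot> u = x \<cdot> u'" by auto
  obtain q where q: "q \<in> N1 \<inter> N2" "u = u' \<cdot> q" using quot u(1,2) by blast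
  have mem: "u' \<in> S" "q \<in> S" "y n \<in> S" using u q N12S VS y by auto
  have "u' \<cdot> x = u' \<cdot> (y n \<cdot> q)" using u(3) mem x(1) unfolding q(2) by (simp add: ac)
  then have xq: "x = y n \<cdot> q" using cancel mem x(1) by blast
  from k obtain v v' where v: "v \<in> V" "v' \<in> V" "y k \<cdot> v = x \<cdot> v'" by auto
  obtain q' where q': "q' \<in> N1 \<inter> N2" "v' = v \<cdot> q'" using quot v(1,2) by blast
  have mem': "v \<in> S" "q' \<in> S" "y k \<in> S" using v q' N12S VS y by auto
  have "v \<cdot> y k = v \<cdot> (x \<cdot> q')" using v(3) mem' x(1) unfolding q'(2) by (simp add: ac)
  then have "y k = x \<cdot> q'" using cancel mem' x(1) by blast
  then have "y k = y n \<cdot> (q \<cdot> q')" using xq assoc mem mem' by simp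
  moreover have "q \<cdot> q' \<in> K" using N(5) q q' K(4) by blast
  ultimately show False using y(2)[OF k(1)] by blast
qed

end

theorem corollary10:
  fixes X :: "'a topology" and m :: "'a \<Rightarrow> 'a \<Rightarrow> 'a"
  assumes "topspace X \<noteq> {}"
    and "topological_semigroup X m"
    and "Hausdorff_space X"
    and "commutative_on (topspace X) m"
    and "cancellative_on (topspace X) m"
    and "locally_compact_space X"
    and "pseudocompact_space X"
    and "open_shifts X m"
  shows "(\<exists>e. topological_group \<lparr>carrier = topspace X, mult = m, one = e\<rparr> X) \<and> compact_space X"
proof -
  interpret topological_semigroup X m by fact
  interpret locally_compact_open_shift_semigroup X m
  proof unfold_locales
    show "openin X (m a ` U)" if "a \<in> topspace X" "openin X U" for a U
      using assms(8) that unfolding open_shifts_def open_map_def by blast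
  qed (use assms in \<open>unfold commutative_on_def cancellative_on_def, blast+\<close>)
  obtain e where G: "group \<lparr>carrier = topspace X, mult = m, one = e\<rparr>"
    using ex_group[OF assms(7,1)] by blast
  interpret G: group "\<lparr>carrier = topspace X, mult = m, one = e\<rparr>" by fact
  have "compact_space X"
    using compact_if_unit[OF assms(7), of e] G.one_closed G.l_one by simp
  then show ?thesis using topological_group_if_group[OF G] by blast
qed

end
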